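(* Let $a>0$, let $\mathbb T=\mathbb R/\mathbb Z$, and let $\Phi:\mathbb T\to\mathbb R$, $\Phi(x)=2\cos(2\pi x)$. For every real $z>0$, set $$c=-a\left(\frac{z\,I_2(z)}{2\,I_1(z)}+1\right),\qquad V_m=-\frac{a z}{I_1(z)}\,I_m(z)\quad(m\ge 1),\qquad v(x)=\sum_{m=1}^\infty V_m\cos(2\pi m x).$$ Then the series defining $v$ converges absolutely and uniformly on $\mathbb T$, $v\in C^\infty(\mathbb T)$ is even and has zero mean, and $u=c+v$ is a nonconstant classical solution of $$a\,u_{xx}+\bigl(u\,(\Phi*u_x)\bigr)_x=0\qquad\text{on }\mathbb T.$$
   Context: The convolution on $\mathbb T$ is $(\Phi*f)(x)=\int_{\mathbb T}\Phi(x-y)f(y)\,dy$. For integers $m\ge 0$, $I_m$ denotes the modified Bessel function of the first kind, $$I_m(z)=\sum_{j=0}^\infty\frac{1}{j!\,\Gamma(j+m+1)}\left(\frac z2\right)^{2j+m}.$$ *)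

theory Defs
  imports "HOL-Analysis.Analysis" "HOL-Library.Periodic_Fun"
begin

text \<open>
  Functions on the circle \<open>\<real>/\<int>\<close> are represented by 1-periodic functions on the reals
  (\<open>periodic_fun_simple'\<close>), and integration over the circle is integration over the
  fundamental domain \<open>[0, 1]\<close>.
\<close>

definition bessel_I :: "nat \<Rightarrow> real \<Rightarrow> real" where
  "bessel_I m z = (\<Sum>j. 1 / (fact j * Gamma (real (j + m + 1))) * (z / 2) ^ (2 * j + m))"

definition torus_conv :: "(real \<Rightarrow> real) \<Rightarrow> (real \<Rightarrow> real) \<Rightarrow> real \<Rightarrow> real" where
  "torus_conv \<Phi> f x = integral {0..1} (\<lambda>y. \<Phi> (x - y) * f y)"

definition torus_smooth :: "(real \<Rightarrow> real) \<Rightarrow> bool" where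
  "torus_smooth f \<longleftrightarrow>
     periodic_fun_simple' f \<and> (\<forall>k x. ((deriv ^^ k) f) differentiable (at x))"

definition torus_C2 :: "(real \<Rightarrow> real) \<Rightarrow> bool" where
  "torus_C2 f \<longleftrightarrow>
     periodic_fun_simple' f \<and>
     (\<forall>x. f differentiable (at x)) \<and>
     (\<forall>x. deriv f differentiable (at x)) \<and>
     continuous_on UNIV (deriv (deriv f))"

text \<open>
  Classical solutions of \<open>a u\<^sub>x\<^sub>x + (u (\<Phi> * u\<^sub>x))\<^sub>x = 0\<close>. As \<open>deriv\<close> is total, the
  differentiability of the flux \<open>u (\<Phi> * u\<^sub>x)\<close> is required explicitly.
\<close>

definition classical_solution :: "real \<Rightarrow> (real \<Rightarrow> real) \<Rightarrow> (real \<Rightarrow> real) \<Rightarrow> bool" where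
  "classical_solution a \<Phi> u \<longleftrightarrow>
     torus_C2 u \<and>
     (\<forall>x. (\<lambda>y. u y * torus_conv \<Phi> (deriv u) y) differentiable (at x)) \<and>
     (\<forall>x. a * deriv (deriv u) x + deriv (\<lambda>y. u y * torus_conv \<Phi> (deriv u) y) x = 0)"

end

(*
  The function u is a multiple of the generating function
    F(t) = I_0(z) + 2 \<Sum>\<^sub>m I_m(z) cos (m t),   t = 2 \<pi> x,
  the value of c being what the recurrence I_0 = I_2 + (2/z) I_1 gives for its constant term.
  Termwise differentiation and the Bessel recurrence show F' = - z sin t F, so F is a positive
  multiple of exp (z cos t). The kernel \<Phi> sees only the first Fourier mode of u, namely V_1 = - a z,
  so \<Phi> * u' = 2 \<pi> a z sin (2 \<pi> x), and the differential equation for F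
  says exactly that a u' + u (\<Phi> * u') = 0.
*)
theory Submission
  imports Defs
begin

section \<open>Bessel functions\<close>

lemma Gamma_real_Suc: "Gamma (real (n + 1)) = fact n"
  using Gamma_fact[of n, where 'a = real] by (simp add: add.commute)

lemma bessel_I_altdef:
  "bessel_I m z = (\<Sum>j. (z / 2) ^ (2 * j + m) / (fact j * fact (j + m)))"
  unfolding bessel_I_def Gamma_real_Suc by (simp add: field_simps)

text \<open>Replacing \<open>fact (j + m)\<close> by \<open>fact m\<close> decouples
  \<open>j\<close> from \<open>m\<close>: what remains in \<open>j\<close> is the exponential series
  of \<open>(z / 2)\<^sup>2\<close>. This gives convergence, and decay in \<open>m\<close> as
  well.\<close>

lemma bessel_I_term_le:
  assumes "z \<ge> (0::real)"
  shows "(z / 2) ^ (2 * j + m) / (fact j * fact (j + m))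
           \<le> (z / 2) ^ m / fact m * (((z / 2)\<^sup>2) ^ j / fact j)"
proof -
  have "(fact m :: real) \<le> fact (j + m)"
    by (rule fact_mono) simp
  then have "(z / 2) ^ (2 * j + m) / (fact j * fact (j + m)) \<le> (z / 2) ^ (2 * j + m) / (fact j * fact m)"
    using assms by (intro divide_left_mono mult_left_mono) auto
  also have "\<dots> = (z / 2) ^ m / fact m * (((z / 2)\<^sup>2) ^ j / fact j)"
    by (simp add: power_add power_mult) (simp add: mult_ac)
  finally show ?thesis .
qed

lemma summable_exp_real: "summable (\<lambda>j. x ^ j / fact j :: real)"
  using summable_exp[of x] by (simp add: field_simps)

lemma exp_real_suminf: "exp (x::real) = (\<Sum>j. x ^ j / fact j)"
  by (simp add: exp_def field_simps)

lemma summable_bessel_I: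
  assumes "z \<ge> (0::real)"
  shows "summable (\<lambda>j. (z / 2) ^ (2 * j + m) / (fact j * fact (j + m)))"
proof (rule summable_comparison_test')
  show "summable (\<lambda>j. (z / 2) ^ m / fact m * (((z / 2)\<^sup>2) ^ j / fact j))"
    by (intro summable_mult summable_exp_real)
  show "norm ((z / 2) ^ (2 * j + m) / (fact j * fact (j + m)))
          \<le> (z / 2) ^ m / fact m * (((z / 2)\<^sup>2) ^ j / fact j)" if "j \<ge> 0" for j
    using bessel_I_term_le[OF assms, of j m] assms by simp
qed

lemma bessel_I_pos:
  assumes "z > 0"
  shows "bessel_I m z > 0"
  unfolding bessel_I_altdef using assms by (intro suminf_pos summable_bessel_I) auto

lemma bessel_I_le:
  assumes "z \<ge> 0"
  shows "bessel_I m z \<le> (z / 2) ^ m / fact m * exp ((z / 2)\<^sup>2)"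
  unfolding bessel_I_altdef exp_real_suminf
    suminf_mult[OF summable_exp_real, symmetric]
  by (intro suminf_le bessel_I_term_le summable_bessel_I summable_mult summable_exp_real assms)

text \<open>Coefficients of equal powers of z are compared, using 1/(j! (j+m)!) - 1/((j-1)!
  (j+m+1)!) = (m+1)/(j! (j+m+1)!).\<close>

lemma bessel_I_recurrence:
  assumes "z > 0"
  shows "z * (bessel_I m z - bessel_I (Suc (Suc m)) z) = 2 * real (Suc m) * bessel_I (Suc m) z"
proof -
  define b where "b m j = (z / 2) ^ (2 * j + m) / (fact j * fact (j + m))" for m j
  have b: "b m sums bessel_I m z" for m
    using summable_sums[OF summable_bessel_I[of z m]] assms
    by (simp add: b_def[abs_def] bessel_I_altdef)
  \<comment> \<open>The series of \<open>bessel_I (Suc (Suc m)) z\<close> delayed by one index, with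
    a zero in front, so that \<open>d j\<close> and \<open>b m j\<close> carry the same power of
    z.\<close>
  define d where "d j = (case j of 0 \<Rightarrow> 0 | Suc i \<Rightarrow> b (Suc (Suc m)) i)" for j
  have d: "d sums bessel_I (Suc (Suc m)) z"
    using b[of "Suc (Suc m)"] sums_Suc_iff[of d "bessel_I (Suc (Suc m)) z"] by (simp add: d_def)
  have "z * (b m j - d j) = 2 * real (Suc m) * b (Suc m) j" for j
  proof (cases j)
    case 0
    then show ?thesis
      using assms by (simp add: b_def d_def field_simps del: of_nat_Suc)
  next
    case (Suc i)
    have f: "(fact (Suc i) :: real) = (real i + 1) * fact i"
      "(fact (Suc i + m) :: real) = fact (Suc (i + m))"
      "(fact (Suc i + Suc m) :: real) = (real i + real m + 2) * fact (Suc (i + m))"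
      "(fact (i + Suc (Suc m)) :: real) = (real i + real m + 2) * fact (Suc (i + m))"
      by (simp_all add: algebra_simps)
    have p: "(z / 2) ^ (2 * Suc i + m) = (z / 2) ^ (2 * i + m) * (z / 2)\<^sup>2"
      "(z / 2) ^ (2 * Suc i + Suc m) = (z / 2) ^ (2 * i + m) * (z / 2)\<^sup>2 * (z / 2)"
      "(z / 2) ^ (2 * i + Suc (Suc m)) = (z / 2) ^ (2 * i + m) * (z / 2)\<^sup>2"
      by (simp_all add: power2_eq_square)
    \<comment> \<open>With the common power and factorial made opaque, the claim is a rational
      identity in i and m.\<close>
    define P G where "P = (z / 2) ^ (2 * i + m) * (z / 2)\<^sup>2" and "G = (fact (Suc (i + m)) :: real)"
    have "real i + 1 \<noteq> 0" "real i + real m + 2 \<noteq> 0" "G \<noteq> 0" "(fact i :: real) \<noteq> 0"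
      by (auto simp: G_def)
    then show ?thesis
      unfolding Suc b_def d_def nat.case f p P_def[symmetric] G_def[symmetric]
      by (simp add: divide_simps) (simp add: algebra_simps)
  qed
  then show ?thesis
    using sums_unique2 sums_mult[OF sums_diff[OF b[of m] d], of z]
      sums_mult[OF b[of "Suc m"], of "2 * real (Suc m)"] by simp
qed

text \<open>The factor 1/m! in the decay of I_m absorbs the weight m, leaving an exponential series.
  This is the majorant for all termwise differentiated series below.\<close>

lemma summable_of_nat_bessel_I:
  assumes "z > 0"
  shows "summable (\<lambda>m. real (Suc m) * bessel_I (Suc m) z)"
proof (rule summable_comparison_test')
  show "summable (\<lambda>m. z / 2 * exp ((z / 2)\<^sup>2) * ((z / 2) ^ m / fact m))"
    by (intro summable_mult summable_exp_real)
  show "norm (real (Suc m) * bessel_I (Suc m) z) \<le> z / 2 * exp ((z / 2)\<^sup>2) * ((z / 2) ^ m / fact m)"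
    if "m \<ge> 0" for m
  proof -
    have "real (Suc m) * bessel_I (Suc m) z
            \<le> real (Suc m) * ((z / 2) ^ Suc m / fact (Suc m) * exp ((z / 2)\<^sup>2))"
      using assms by (intro mult_left_mono bessel_I_le) auto
    also have "\<dots> = z / 2 * exp ((z / 2)\<^sup>2) * ((z / 2) ^ m / fact m)"
      by (simp add: field_simps del: of_nat_Suc)
    finally show ?thesis
      using bessel_I_pos[OF assms, of "Suc m"] by simp
  qed
qed

lemma summable_bessel_I_index:
  assumes "z > 0"
  shows "summable (\<lambda>m. bessel_I (Suc m) z)"
proof (rule summable_comparison_test'[OF summable_of_nat_bessel_I[OF assms]])
  show "norm (bessel_I (Suc m) z) \<le> real (Suc m) * bessel_I (Suc m) z" if "m \<ge> 0" for m
    using bessel_I_pos[OF assms, of "Suc m"] by (simp add: field_simps)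
qed

section \<open>The generating function\<close>

text \<open>For z > 0 this is the Jacobi-Anger series of exp (z cos t); below it is identified only
  up to a positive factor.\<close>

definition bessel_gen :: "real \<Rightarrow> real \<Rightarrow> real" where
  "bessel_gen z t = bessel_I 0 z + 2 * (\<Sum>m. bessel_I (Suc m) z * cos (real (Suc m) * t))"

lemma summable_bessel_I_mult:
  assumes "z > 0" "\<And>m. \<bar>g m\<bar> \<le> (1::real)"
  shows "summable (\<lambda>m. \<bar>bessel_I (Suc m) z * g m\<bar>)" "summable (\<lambda>m. bessel_I (Suc m) z * g m)"
proof -
  show s: "summable (\<lambda>m. \<bar>bessel_I (Suc m) z * g m\<bar>)"
  proof (rule summable_comparison_test'[OF summable_bessel_I_index[OF assms(1)]])
    show "norm \<bar>bessel_I (Suc m) z * g m\<bar> \<le> bessel_I (Suc m) z" if "m \<ge> 0" for m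
      using bessel_I_pos[OF assms(1), of "Suc m"] mult_left_mono[OF assms(2)[of m], of "bessel_I (Suc m) z"]
      by (simp add: abs_mult)
  qed
  then show "summable (\<lambda>m. bessel_I (Suc m) z * g m)"
    by (rule summable_rabs_cancel)
qed

text \<open>The equation F' = - z sin t F at the level of series. The recurrence turns 2 m I_m into
  z (I_{m-1} - I_{m+1}); after reindexing, sin ((m+1) t) - sin ((m-1) t) = 2 sin t cos (m t) brings
  out the factor sin t.\<close>

lemma bessel_sin_series_eq:
  assumes "z > 0"
  shows "2 * (\<Sum>m. bessel_I (Suc m) z * (real (Suc m) * sin (real (Suc m) * t))) = z * sin t * bessel_gen z t"
proof -
  have s: "summable (\<lambda>m. bessel_I (Suc m) z * sin (g m))"
    "summable (\<lambda>m. bessel_I (Suc m) z * cos (g m))" for g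
    using summable_bessel_I_mult[OF assms] by auto
  \<comment> \<open>Splitting off the term m = 0 supplies the constant term I_0 of
    \<open>bessel_gen\<close>.\<close>
  have A: "(\<lambda>m. bessel_I m z * sin (real (Suc m) * t)) sums
      ((\<Sum>m. bessel_I (Suc m) z * sin (real (Suc (Suc m)) * t)) + bessel_I 0 z * sin t)"
    using summable_sums[OF s(1)[of "\<lambda>m. real (Suc (Suc m)) * t"]]
      sums_Suc[of "\<lambda>m. bessel_I m z * sin (real (Suc m) * t)"] by simp
  \<comment> \<open>Here the shift adds the term I_1 sin 0, which vanishes.\<close>
  have B: "(\<lambda>m. bessel_I (Suc (Suc m)) z * sin (real (Suc m) * t)) sums
      (\<Sum>m. bessel_I (Suc m) z * sin (real m * t))"
    using summable_sums[OF s(1)[of "\<lambda>m. real m * t"]]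
      sums_Suc_iff[of "\<lambda>m. bessel_I (Suc m) z * sin (real m * t)"] by simp
  have "(\<lambda>m. z * (bessel_I m z * sin (real (Suc m) * t) - bessel_I (Suc (Suc m)) z * sin (real (Suc m) * t)))
      = (\<lambda>m. 2 * (bessel_I (Suc m) z * (real (Suc m) * sin (real (Suc m) * t))))"
  proof
    fix m
    show "z * (bessel_I m z * sin (real (Suc m) * t) - bessel_I (Suc (Suc m)) z * sin (real (Suc m) * t))
      = 2 * (bessel_I (Suc m) z * (real (Suc m) * sin (real (Suc m) * t)))"
      using arg_cong[OF bessel_I_recurrence[OF assms, of m], of "\<lambda>r. r * sin (real (Suc m) * t)"]
      by (simp only: left_diff_distrib right_diff_distrib mult_ac)
  qed
  then have C: "(\<lambda>m. 2 * (bessel_I (Suc m) z * (real (Suc m) * sin (real (Suc m) * t)))) sums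
      (z * ((\<Sum>m. bessel_I (Suc m) z * sin (real (Suc (Suc m)) * t)) + bessel_I 0 z * sin t
         - (\<Sum>m. bessel_I (Suc m) z * sin (real m * t))))"
    using sums_mult[OF sums_diff[OF A B], of z] by simp
  have "(\<Sum>m. bessel_I (Suc m) z * sin (real (Suc (Suc m)) * t)) - (\<Sum>m. bessel_I (Suc m) z * sin (real m * t))
      = (\<Sum>m. bessel_I (Suc m) z * sin (real (Suc (Suc m)) * t) - bessel_I (Suc m) z * sin (real m * t))"
    by (intro suminf_diff s)
  also have "\<dots> = (\<Sum>m. 2 * sin t * (bessel_I (Suc m) z * cos (real (Suc m) * t)))"
  proof (rule suminf_cong)
    fix m
    have "real (Suc (Suc m)) * t = real (Suc m) * t + t" "real m * t = real (Suc m) * t - t"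
      by (simp_all add: algebra_simps)
    then show "bessel_I (Suc m) z * sin (real (Suc (Suc m)) * t) - bessel_I (Suc m) z * sin (real m * t)
        = 2 * sin t * (bessel_I (Suc m) z * cos (real (Suc m) * t))"
      by (simp only: sin_add sin_diff) (simp add: algebra_simps)
  qed
  also have "\<dots> = 2 * sin t * (\<Sum>m. bessel_I (Suc m) z * cos (real (Suc m) * t))"
    by (intro suminf_mult s)
  finally have D: "(\<Sum>m. bessel_I (Suc m) z * sin (real (Suc (Suc m)) * t))
      = (\<Sum>m. bessel_I (Suc m) z * sin (real m * t))
        + 2 * sin t * (\<Sum>m. bessel_I (Suc m) z * cos (real (Suc m) * t))" by simp
  have "summable (\<lambda>m. bessel_I (Suc m) z * (real (Suc m) * sin (real (Suc m) * t)))"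
    using C by (auto dest: sums_summable)
  then have "2 * (\<Sum>m. bessel_I (Suc m) z * (real (Suc m) * sin (real (Suc m) * t)))
     = (\<Sum>m. 2 * (bessel_I (Suc m) z * (real (Suc m) * sin (real (Suc m) * t))))"
    by (simp add: suminf_mult)
  also have "\<dots> = z * sin t * bessel_gen z t"
    using sums_unique[OF C] unfolding D bessel_gen_def by (simp add: algebra_simps)
  finally show ?thesis .
qed

lemma abs_bessel_sin_term_le:
  assumes "z > 0"
  shows "\<bar>bessel_I (Suc m) z * (real (Suc m) * sin s)\<bar> \<le> real (Suc m) * bessel_I (Suc m) z"
  using bessel_I_pos[OF assms, of "Suc m"]
    mult_left_mono[OF abs_sin_le_one[of s], of "real (Suc m) * bessel_I (Suc m) z"]
  by (simp add: abs_mult mult_ac)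

lemma bessel_gen_has_derivative:
  assumes "z > 0"
  shows "(bessel_gen z has_real_derivative - z * sin t * bessel_gen z t) (at t)"
proof -
  have "((\<lambda>t. \<Sum>m. bessel_I (Suc m) z * cos (real (Suc m) * t)) has_real_derivative
      (\<Sum>m. - (bessel_I (Suc m) z * (real (Suc m) * sin (real (Suc m) * t))))) (at t)"
  proof (rule has_field_derivative_series'(2)[where S = UNIV and ?x0.0 = 0])
    \<comment> \<open>Uniform convergence is needed for the differentiated series; for the original
      one, convergence at the single point 0 suffices.\<close>
    show "uniformly_convergent_on UNIV
       (\<lambda>n t. \<Sum>m<n. - (bessel_I (Suc m) z * (real (Suc m) * sin (real (Suc m) * t))))"
      using abs_bessel_sin_term_le[OF assms]
      by (intro Weierstrass_m_test'[OF _ summable_of_nat_bessel_I[OF assms]]) (auto simp del: of_nat_Suc)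
    show "summable (\<lambda>m. bessel_I (Suc m) z * cos (real (Suc m) * 0))"
      using summable_bessel_I_index[OF assms] by simp
  qed (auto intro!: derivative_eq_intros simp del: of_nat_Suc)
  moreover have "summable (\<lambda>m. bessel_I (Suc m) z * (real (Suc m) * sin (real (Suc m) * t)))"
    by (rule summable_comparison_test'[OF summable_of_nat_bessel_I[OF assms]])
      (use abs_bessel_sin_term_le[OF assms] in simp)
  ultimately have "((\<lambda>t. \<Sum>m. bessel_I (Suc m) z * cos (real (Suc m) * t)) has_real_derivative
      - (\<Sum>m. (bessel_I (Suc m) z * (real (Suc m) * sin (real (Suc m) * t))))) (at t)"
    by (simp only: suminf_minus)
  from DERIV_add[OF DERIV_const[of "bessel_I 0 z"] DERIV_cmult[OF this, of 2]] show ?thesis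
    using bessel_sin_series_eq[OF assms, of t] by (simp add: bessel_gen_def[abs_def])
qed

text \<open>The integrating factor exp (- z cos t) makes the product constant; its value is read off
  at t = 0.\<close>

lemma bessel_gen_eq_exp:
  assumes "z > 0"
  shows "bessel_gen z t = bessel_gen z 0 * exp (- z) * exp (z * cos t)"
proof -
  have "((\<lambda>t. bessel_gen z t * exp (- (z * cos t))) has_real_derivative 0) (at t)" for t
    by (auto intro!: derivative_eq_intros bessel_gen_has_derivative[OF assms])
  then have "bessel_gen z t * exp (- (z * cos t)) = bessel_gen z 0 * exp (- (z * cos 0))"
    using DERIV_isconst_all by blast
  then show ?thesis
    by (simp add: exp_minus field_simps)
qed

lemma bessel_gen_0_pos:
  assumes "z > 0"
  shows "bessel_gen z 0 > 0"
  using bessel_I_pos[OF assms] suminf_nonneg[OF summable_bessel_I_index[OF assms]]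
  by (simp add: bessel_gen_def add_pos_nonneg less_imp_le)

section \<open>Fourier integrals\<close>

text \<open>Uniform convergence lets the integral pass to the limit of the partial sums, whose
  integrals are the partial sums of \<open>J\<close>.\<close>

lemma has_integral_suminf_Weierstrass:
  fixes h :: "nat \<Rightarrow> real \<Rightarrow> real"
  assumes "\<And>m. continuous_on {p..q} (h m)"
    and "\<And>m y. y \<in> {p..q} \<Longrightarrow> \<bar>h m y\<bar> \<le> B m" "summable B"
    and "\<And>m. (h m has_integral J m) {p..q}"
  shows "((\<lambda>y. \<Sum>m. h m y) has_integral (\<Sum>m. J m)) {p..q}"
proof -
  have u: "uniform_limit {p..q} (\<lambda>n y. \<Sum>m<n. h m y) (\<lambda>y. \<Sum>m. h m y) sequentially"
    using assms(2,3) by (intro Weierstrass_m_test) auto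
  have c: "continuous_on {p..q} (\<lambda>y. \<Sum>m<n. h m y)" for n
    using assms(1) by (intro continuous_on_sum)
  obtain I K where I: "\<And>n. ((\<lambda>y. \<Sum>m<n. h m y) has_integral I n) {p..q}"
    and K: "((\<lambda>y. \<Sum>m. h m y) has_integral K) {p..q}" and L: "I \<longlonglongrightarrow> K"
    using uniform_limit_integral[OF u c] by auto
  have "((\<lambda>y. \<Sum>m<n. h m y) has_integral (\<Sum>m<n. J m)) {p..q}" for n
    using assms(4) by (intro has_integral_sum) auto
  then have "I = (\<lambda>n. \<Sum>m<n. J m)"
    using I has_integral_unique by blast
  then have "J sums K"
    using L by (simp add: sums_def)
  then show ?thesis
    using K sums_unique by blast
qed

text \<open>The free phase \<open>s\<close> lets this one integral serve for cosines (s = pi/2) and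
  for products of modes.\<close>

lemma sin_period_has_integral:
  "((\<lambda>y. sin (s + 2 * pi * of_int k * y)) has_integral (if k = 0 then sin s else 0)) {0..1}"
proof (cases "k = 0")
  case True
  then show ?thesis
    using has_integral_const_real[of "sin s" 0 1] by simp
next
  case False
  have "((\<lambda>y. sin (s + 2 * pi * of_int k * y)) has_integral
     (- cos (s + 2 * pi * of_int k * 1) / (2 * pi * of_int k)) - (- cos (s + 2 * pi * of_int k * 0) / (2 * pi * of_int k))) {0..1}"
    using False
    by (intro fundamental_theorem_of_calculus)
      (auto intro!: derivative_eq_intros simp flip: has_real_derivative_iff_has_vector_derivative)
  moreover have "cos (s + 2 * pi * of_int k) = cos s"
    by (simp add: cos_add)
  ultimately show ?thesis
    using False by simp
qed

lemma cos_period_has_integral: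
  "((\<lambda>y. cos (2 * pi * real (Suc m) * y)) has_integral 0) {0..1}"
proof -
  have "(\<lambda>y. cos (2 * pi * real (Suc m) * y)) = (\<lambda>y. sin (pi / 2 + 2 * pi * of_int (int (Suc m)) * y))"
    by (simp add: sin_add)
  then show ?thesis
    using sin_period_has_integral[of "pi / 2" "int (Suc m)"] by simp
qed

text \<open>The product splits into sines of frequencies m and m + 2 in y. Only the first frequency
  can be zero, at m = 0, so the kernel detects just the first Fourier mode.\<close>

lemma cos_sin_period_has_integral:
  "((\<lambda>y. 2 * cos (2 * pi * (x - y)) * sin (2 * pi * real (Suc m) * y)) has_integral
     (if m = 0 then sin (2 * pi * x) else 0)) {0..1}"
proof -
  have "2 * cos (2 * pi * (x - y)) * sin (2 * pi * real (Suc m) * y)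
     = sin (2 * pi * x + 2 * pi * of_int (int m) * y) + sin (- (2 * pi * x) + 2 * pi * of_int (int m + 2) * y)" for y
  proof -
    have "2 * pi * x + 2 * pi * of_int (int m) * y = 2 * pi * (x - y) + 2 * pi * real (Suc m) * y"
      "- (2 * pi * x) + 2 * pi * of_int (int m + 2) * y = 2 * pi * real (Suc m) * y - 2 * pi * (x - y)"
      by (simp_all add: algebra_simps)
    then show ?thesis
      by (simp only: sin_add sin_diff) simp
  qed
  then show ?thesis
    using has_integral_add[OF sin_period_has_integral[of "2 * pi * x" "int m"]
        sin_period_has_integral[of "- (2 * pi * x)" "int m + 2"]]
    by (auto split: if_splits)
qed

section \<open>Smoothness\<close>

text \<open>A class of functions that is visibly closed under differentiation.\<close>

inductive trig_exp :: "real \<Rightarrow> (real \<Rightarrow> real) \<Rightarrow> bool" for z where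
  const: "trig_exp z (\<lambda>_. k)"
| sin: "trig_exp z (\<lambda>x. sin (2 * pi * x))"
| cos: "trig_exp z (\<lambda>x. cos (2 * pi * x))"
| exp: "trig_exp z (\<lambda>x. exp (z * cos (2 * pi * x)))"
| add: "trig_exp z f \<Longrightarrow> trig_exp z g \<Longrightarrow> trig_exp z (\<lambda>x. f x + g x)"
| mult: "trig_exp z f \<Longrightarrow> trig_exp z g \<Longrightarrow> trig_exp z (\<lambda>x. f x * g x)"

lemma trig_exp_has_derivative:
  assumes "trig_exp z f"
  shows "\<exists>f'. trig_exp z f' \<and> (\<forall>x. (f has_real_derivative f' x) (at x))"
  using assms
proof induction
  case (const k)
  show ?case
    by (rule exI[of _ "\<lambda>_. 0"]) (auto intro: trig_exp.intros)
next
  case sin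
  show ?case
    by (rule exI[of _ "\<lambda>x. 2 * pi * cos (2 * pi * x)"])
      (auto intro!: trig_exp.intros derivative_eq_intros)
next
  case cos
  have "trig_exp z (\<lambda>x. - (2 * pi) * sin (2 * pi * x))"
    by (intro trig_exp.intros)
  then show ?case
    by (intro exI[of _ "\<lambda>x. - (2 * pi) * sin (2 * pi * x)"]) (auto intro!: derivative_eq_intros)
next
  case exp
  have "trig_exp z (\<lambda>x. - (2 * pi * z) * sin (2 * pi * x) * exp (z * cos (2 * pi * x)))"
    by (intro trig_exp.intros)
  then show ?case
    by (intro exI[of _ "\<lambda>x. - (2 * pi * z) * sin (2 * pi * x) * exp (z * cos (2 * pi * x))"])
      (auto intro!: derivative_eq_intros)
next
  case (add f g)
  then obtain f' g' where "trig_exp z f'" "trig_exp z g'"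
    "\<forall>x. (f has_real_derivative f' x) (at x)" "\<forall>x. (g has_real_derivative g' x) (at x)" by blast
  then show ?case
    by (intro exI[of _ "\<lambda>x. f' x + g' x"]) (auto intro!: trig_exp.intros derivative_eq_intros)
next
  case (mult f g)
  then obtain f' g' where "trig_exp z f'" "trig_exp z g'"
    "\<forall>x. (f has_real_derivative f' x) (at x)" "\<forall>x. (g has_real_derivative g' x) (at x)" by blast
  then show ?case using mult
    by (intro exI[of _ "\<lambda>x. f' x * g x + g' x * f x"]) (auto intro!: trig_exp.intros derivative_eq_intros)
qed

lemma trig_exp_deriv:
  assumes "trig_exp z f"
  shows "trig_exp z (deriv f)" "f differentiable (at x)"
proof -
  obtain f' where f': "trig_exp z f'" "\<And>x. (f has_real_derivative f' x) (at x)"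
    using trig_exp_has_derivative[OF assms] by blast
  then have "deriv f = f'"
    by (intro ext DERIV_imp_deriv)
  with f'(1) show "trig_exp z (deriv f)" by simp
  show "f differentiable (at x)"
    using f'(2) real_differentiable_def by blast
qed

lemma trig_exp_periodic:
  assumes "trig_exp z f"
  shows "f (x + 1) = f x"
  using assms by induction (auto simp: distrib_left sin_add cos_add)

lemma trig_exp_torus_smooth:
  assumes "trig_exp z f"
  shows "torus_smooth f"
proof -
  have "trig_exp z ((deriv ^^ k) f)" for k
    by (induction k) (auto intro: assms trig_exp_deriv)
  then show ?thesis
    unfolding torus_smooth_def periodic_fun_simple'_def
    using trig_exp_deriv trig_exp_periodic[OF assms] by blast
qed

text \<open>The second derivative lies in the class again, so it is differentiable and hence
  continuous.\<close>

lemma trig_exp_torus_C2: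
  assumes "trig_exp z f"
  shows "torus_C2 f"
  unfolding torus_C2_def periodic_fun_simple'_def
  using trig_exp_deriv trig_exp_periodic[OF assms] assms
  by (metis continuous_at_imp_continuous_on differentiable_imp_continuous_within)

section \<open>The stationary solution\<close>

theorem mainTheorem2:
  fixes a z c :: real and V :: "nat \<Rightarrow> real" and \<Phi> v u :: "real \<Rightarrow> real"
  assumes "a > 0"
    and "\<Phi> = (\<lambda>x. 2 * cos (2 * pi * x))"
    and "z > 0"
    and "c = - a * (z * bessel_I 2 z / (2 * bessel_I 1 z) + 1)"
    and "\<And>m. m \<ge> 1 \<Longrightarrow> V m = - (a * z / bessel_I 1 z) * bessel_I m z"
    and "v = (\<lambda>x. \<Sum>m. V (Suc m) * cos (2 * pi * real (Suc m) * x))"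
    and "u = (\<lambda>x. c + v x)"
  shows "(\<forall>x. summable (\<lambda>m. \<bar>V (Suc m) * cos (2 * pi * real (Suc m) * x)\<bar>)) \<and>
         uniform_limit UNIV (\<lambda>N x. \<Sum>m=1..N. V m * cos (2 * pi * real m * x)) v sequentially \<and>
         torus_smooth v \<and>
         (\<forall>x. v (- x) = v x) \<and>
         (v has_integral 0) {0..1} \<and>
         classical_solution a \<Phi> u \<and>
         \<not> u constant_on UNIV"
proof -
  note z = \<open>z > 0\<close>
  \<comment> \<open>The common factor in V_m = - A I_m. Its normalisation A I_1 = a z fixes the
    first amplitude at - a z.\<close>
  define A where "A = a * z / bessel_I 1 z"
  have A: "A > 0" "A * bessel_I 1 z = a * z"
    using assms(1) z bessel_I_pos[OF z, of 1] by (simp_all add: A_def)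
  have V: "V (Suc m) = - A * bessel_I (Suc m) z" for m
    using assms(5)[of "Suc m"] by (simp add: A_def)
  have V_term: "V (Suc m) * cos (2 * pi * real (Suc m) * x)
      = - A * (bessel_I (Suc m) z * cos (real (Suc m) * (2 * pi * x)))" for m x
    unfolding V by (simp add: mult_ac)
  have V_bound: "\<bar>V (Suc m) * cos (2 * pi * real (Suc m) * x)\<bar> \<le> A * bessel_I (Suc m) z" for m x
    using A(1) bessel_I_pos[OF z, of "Suc m"]
      mult_left_mono[OF abs_cos_le_one[of "2 * pi * real (Suc m) * x"], of "A * bessel_I (Suc m) z"]
    unfolding V by (simp add: abs_mult)
  have summable_bound: "summable (\<lambda>m. A * bessel_I (Suc m) z)"
    by (intro summable_mult summable_bessel_I_index z)

  have abs_summable: "summable (\<lambda>m. \<bar>V (Suc m) * cos (2 * pi * real (Suc m) * x)\<bar>)" for x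
    by (rule summable_comparison_test'[OF summable_bound]) (use V_bound in simp)

  have "uniform_limit UNIV (\<lambda>N x. \<Sum>m<N. V (Suc m) * cos (2 * pi * real (Suc m) * x)) v sequentially"
    unfolding assms(6) using V_bound by (intro Weierstrass_m_test[OF _ summable_bound]) auto
  then have unif: "uniform_limit UNIV (\<lambda>N x. \<Sum>m=1..N. V m * cos (2 * pi * real m * x)) v sequentially"
    by (simp add: sum.atLeast1_atMost_eq)

  have mean: "(v has_integral 0) {0..1}"
  proof -
    have "((\<lambda>x. \<Sum>m. V (Suc m) * cos (2 * pi * real (Suc m) * x)) has_integral (\<Sum>m. V (Suc m) * 0)) {0..1}"
      by (intro has_integral_suminf_Weierstrass[OF _ V_bound summable_bound] continuous_intros
          has_integral_mult_right cos_period_has_integral)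
    then show ?thesis
      by (simp add: assms(6))
  qed

  \<comment> \<open>Collects the factor - A/2 relating \<open>u\<close> to \<open>bessel_gen\<close>
    and the constant of \<open>bessel_gen_eq_exp\<close>, so that u = K exp (z cos (2 pi
    x)).\<close>
  define K where "K = - A / 2 * (bessel_gen z 0 * exp (- z))"
  have "K \<noteq> 0"
    using A(1) bessel_gen_0_pos[OF z] by (simp add: K_def)
  \<comment> \<open>The recurrence at m = 0, divided by 2 I_1, reads z I_0 / (2 I_1) = z I_2 / (2
    I_1) + 1 = - c / a.\<close>
  have c: "c = - A / 2 * bessel_I 0 z"
  proof -
    have "z * bessel_I 0 z = z * bessel_I 2 z + 2 * bessel_I 1 z"
      using bessel_I_recurrence[OF z, of 0] by (simp add: numeral_2_eq_2 algebra_simps)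
    then show ?thesis
      using bessel_I_pos[OF z, of 1] unfolding assms(4) A_def
      by (simp add: field_simps)
  qed
  have v_series: "v x = - A * (\<Sum>m. bessel_I (Suc m) z * cos (real (Suc m) * (2 * pi * x)))" for x
    unfolding assms(6) V_term using summable_bessel_I_mult(2)[OF z]
    by (intro suminf_mult) auto
  have u_gen: "u x = - A / 2 * bessel_gen z (2 * pi * x)" for x
    unfolding assms(7) v_series c bessel_gen_def by (simp add: algebra_simps)
  have u: "u = (\<lambda>x. K * exp (z * cos (2 * pi * x)))"
    by (rule ext) (simp add: u_gen bessel_gen_eq_exp[OF z, of "2 * pi * _"] K_def)
  have v: "v = (\<lambda>x. K * exp (z * cos (2 * pi * x)) + (- c))"
    using assms(7) by (auto simp: u fun_eq_iff dest!: spec)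
  have u': "deriv u x = - (2 * pi * z) * sin (2 * pi * x) * u x" for x
    unfolding u by (rule DERIV_imp_deriv) (auto intro!: derivative_eq_intros)

  \<comment> \<open>The product form of u' suits the differential equation, the sine series suits
    the convolution. The latter follows from \<open>bessel_sin_series_eq\<close> without
    differentiating again.\<close>
  have u'_series: "deriv u y
      = (\<Sum>m. 2 * pi * A * (bessel_I (Suc m) z * (real (Suc m) * sin (real (Suc m) * (2 * pi * y)))))" for y
  proof -
    have "summable (\<lambda>m. bessel_I (Suc m) z * (real (Suc m) * sin (real (Suc m) * (2 * pi * y))))"
      by (rule summable_comparison_test'[OF summable_of_nat_bessel_I[OF z]])
        (use abs_bessel_sin_term_le[OF z] in simp)
    then show ?thesis
      using bessel_sin_series_eq[OF z, of "2 * pi * y"] by (simp add: suminf_mult u' u_gen)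
  qed
  have conv: "torus_conv \<Phi> (deriv u) x = 2 * pi * a * z * sin (2 * pi * x)" for x
  proof -
    define h where "h m y = 2 * pi * A * real (Suc m) * bessel_I (Suc m) z *
        (2 * cos (2 * pi * (x - y)) * sin (2 * pi * real (Suc m) * y))" for m y
    define J where "J m = 2 * pi * A * real (Suc m) * bessel_I (Suc m) z *
        (if m = 0 then sin (2 * pi * x) else 0)" for m
    have "((\<lambda>y. \<Sum>m. h m y) has_integral (\<Sum>m. J m)) {0..1}"
    proof (rule has_integral_suminf_Weierstrass)
      show "continuous_on {0..1} (h m)" for m
        unfolding h_def by (intro continuous_intros)
      \<comment> \<open>The constant 4 pi is the 2 pi of the differentiated series times the 2 of
        the kernel.\<close>
      show "summable (\<lambda>m. 4 * pi * A * (real (Suc m) * bessel_I (Suc m) z))"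
        by (intro summable_mult summable_of_nat_bessel_I z)
      show "(h m has_integral J m) {0..1}" for m
        unfolding h_def J_def by (intro has_integral_mult_right cos_sin_period_has_integral)
      show "\<bar>h m y\<bar> \<le> 4 * pi * A * (real (Suc m) * bessel_I (Suc m) z)" for m y
      proof -
        have "\<bar>h m y\<bar> = 4 * pi * A * (real (Suc m) * bessel_I (Suc m) z) *
            (\<bar>cos (2 * pi * (x - y))\<bar> * \<bar>sin (2 * pi * real (Suc m) * y)\<bar>)"
          using A(1) bessel_I_pos[OF z, of "Suc m"] by (simp add: h_def abs_mult del: of_nat_Suc)
        also have "\<dots> \<le> 4 * pi * A * (real (Suc m) * bessel_I (Suc m) z) * 1"
          using A(1) bessel_I_pos[OF z, of "Suc m"]
          by (intro mult_left_mono mult_le_one) (auto simp: less_imp_le)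
        finally show ?thesis by simp
      qed
    qed
    moreover have "(\<Sum>m. h m y) = \<Phi> (x - y) * deriv u y" for y
    proof -
      have s: "summable (\<lambda>m. 2 * pi * A * (bessel_I (Suc m) z * (real (Suc m) * sin (real (Suc m) * (2 * pi * y)))))"
        by (intro summable_mult summable_comparison_test'[OF summable_of_nat_bessel_I[OF z]])
          (use abs_bessel_sin_term_le[OF z] in simp)
      show ?thesis
        unfolding u'_series suminf_mult[OF s, symmetric]
        by (rule suminf_cong) (simp add: h_def assms(2) mult_ac)
    qed
    \<comment> \<open>Only the first mode survives, with weight 2 pi A I_1 = 2 pi a z.\<close>
    moreover have "(\<Sum>m. J m) = J 0"
    proof -
      have "J m = 0" if "m \<notin> {0}" for m
        using that by (simp add: J_def)
      then show ?thesis
        using suminf_finite[of "{0}" J] by simp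
    qed
    ultimately have "((\<lambda>y. \<Phi> (x - y) * deriv u y) has_integral J 0) {0..1}"
      by simp
    then show ?thesis
      using A(2) by (simp add: torus_conv_def integral_unique J_def)
  qed

  have "trig_exp z v"
    unfolding v by (intro trig_exp.intros)
  then have smooth: "torus_smooth v"
    by (rule trig_exp_torus_smooth)
  have even: "v (- x) = v x" for x
    by (simp add: v)

  have te: "trig_exp z u"
    unfolding u by (intro trig_exp.intros)
  \<comment> \<open>The once integrated equation, with integration constant zero. It also reduces
    differentiability of the flux to that of \<open>deriv u\<close>.\<close>
  have flux: "(\<lambda>y. u y * torus_conv \<Phi> (deriv u) y) = (\<lambda>y. - a * deriv u y)"
    by (simp add: conv u' fun_eq_iff)
  have du: "deriv u differentiable (at x)" for x
    using trig_exp_deriv te by blast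
  have "a * deriv (deriv u) x + deriv (\<lambda>y. - a * deriv u y) x = 0" for x
  proof -
    have "(deriv u has_real_derivative deriv (deriv u) x) (at x)"
      using du DERIV_deriv_iff_real_differentiable by blast
    from DERIV_imp_deriv[OF DERIV_cmult[OF this, of "- a"]] show ?thesis
      by simp
  qed
  then have solution: "classical_solution a \<Phi> u"
    unfolding classical_solution_def flux
    using trig_exp_torus_C2[OF te] du by (auto intro!: derivative_intros)

  \<comment> \<open>The two values are K exp z and K exp (- z), at the maximum and minimum of the
    cosine.\<close>
  have "u 0 \<noteq> u (1 / 2)"
    using \<open>K \<noteq> 0\<close> z by (simp add: u)
  then have "\<not> u constant_on UNIV"
    by (metis constant_on_def UNIV_I)
  with abs_summable unif smooth even mean solution show ?thesis by blast
qed

end
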